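(* Let $f:\mathbb{R}\to\mathbb{R}$ be a $\mathcal{C}^\infty$ function all of whose derivatives grow at most polynomially at infinity, and suppose $f''>0$ on $\mathbb{R}$. Let $\mu\in(0,1]$ and let $p_1$ be a finite real number. Let $u_0$ be a tempered distribution on $\mathbb{R}$ with $\mathcal{F}u_0\in L^1(\mathbb{R})$, and suppose there is a bounded differentiable function $\tilde u:\mathbb{R}\to\mathbb{C}$ with $\tilde u'\in L^1(\mathbb{R})$, and with $\tilde u(p_1)\neq0$ if $\mu\neq1$, such that $$\mathcal{F}u_0(p)=|p-p_1|^{\mu-1}\,\tilde u(p)\qquad\text{for all }p\in\mathbb{R}\setminus\{p_1\}.$$ Let $u$ be the solution of $[i\partial_t-f(D)]u=0$, $u(0,\cdot)=u_0$, given by $$u(t,x)=\frac{1}{2\pi}\int_{\mathbb{R}}\mathcal{F}u_0(p)\,e^{-itf(p)+ixp}\,dp ,\qquad t>0,\ x\in\mathbb{R}.$$ Let $\eta>\varepsilon>0$ be finite real numbers. Then for all $(t,x)\in\mathfrak{C}\big(f'(p_1-\varepsilon),f'(p_1+\varepsilon)\big)$, $$|u(t,x)|\leqslant c^{(1)}_\eta(u_0,f)\,t^{-\frac\mu2}+c^{(2)}_{\eta,\varepsilon}(u_0,f)\,t^{-1},$$ where $c^{(1)}_\eta(u_0,f):=c^{(1)}_{1,\eta}(u_0,f)+c^{(1)}_{2,\eta}(u_0,f)$ with $$c^{(1)}_{1,\eta}(u_0,f):=\frac{1}{2\pi}\,\frac3\mu\,\|\tilde u\|_{L^\infty(p_1-\eta,p_1)}+\frac1\pi\Big(4\|\tilde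 u\|_{L^\infty(p_1-\eta,p_1)}+\|\tilde u'\|_{L^1(p_1-\eta,p_1)}\Big)\Big(\min_{p\in[p_1-\eta,p_1]}f''(p)\Big)^{-1},$$ $$c^{(1)}_{2,\eta}(u_0,f):=\frac{1}{2\pi}\,\frac3\mu\,\|\tilde u\|_{L^\infty(p_1,p_1+\eta)}+\frac1\pi\Big(4\|\tilde u\|_{L^\infty(p_1,p_1+\eta)}+\|\tilde u'\|_{L^1(p_1,p_1+\eta)}\Big)\Big(\min_{p\in[p_1,p_1+\eta]}f''(p)\Big)^{-1},$$ and $$c^{(2)}_{\eta,\varepsilon}(u_0,f):=\frac{1}{2\pi}\,\eta^{\mu-1}\Big(4\|\tilde u\|_{L^\infty(\mathbb{R})}+\|\tilde u'\|_{L^1(\mathbb{R})}\Big)\Big(\tilde m_{1,\eta,\varepsilon}^{-1}+\tilde m_{2,\eta,\varepsilon}^{-1}\Big),$$ with $\tilde m_{1,\eta,\varepsilon}:=f'(p_1+\eta)-f'(p_1+\varepsilon)>0$ and $\tilde m_{2,\eta,\varepsilon}:=f'(p_1-\varepsilon)-f'(p_1-\eta)>0$.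
   Context: Fourier transform convention: $\mathcal{F}v(p)=\int_{\mathbb{R}}v(x)e^{-ixp}\,dx$, extended to tempered distributions. $f(D)$ is the Fourier multiplier $f(D)v=\mathcal{F}^{-1}(f\,\mathcal{F}v)$. Since $\mathcal{F}u_0\in L^1(\mathbb{R})$, the formula for $u$ is well defined for all $t>0$, $x\in\mathbb{R}$. Space-time cone: for real $a<b$, $\mathfrak{C}(a,b):=\{(t,x)\in(0,+\infty)\times\mathbb{R} : a\leqslant \frac{x}{t}\leqslant b\}$. *)

theory Defs
  imports "HOL-Probability.Essential_Supremum"
begin

definition smooth_poly_growth :: "(real \<Rightarrow> real) \<Rightarrow> bool" where
  "smooth_poly_growth f \<longleftrightarrow>
     (\<forall>n x. (deriv ^^ n) f field_differentiable (at x)) \<and>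
     (\<forall>n. \<exists>C k. \<forall>x. \<bar>(deriv ^^ n) f x\<bar> \<le> C * (1 + \<bar>x\<bar>) ^ k)"

definition higher_vderiv :: "nat \<Rightarrow> (real \<Rightarrow> complex) \<Rightarrow> real \<Rightarrow> complex" where
  "higher_vderiv n \<phi> = ((\<lambda>g x. vector_derivative g (at x)) ^^ n) \<phi>"

definition schwartz :: "(real \<Rightarrow> complex) set" where
  "schwartz = {\<phi>. (\<forall>n x. higher_vderiv n \<phi> differentiable (at x)) \<and>
                  (\<forall>k n. bounded (range (\<lambda>x. x ^ k *\<^sub>R higher_vderiv n \<phi> x)))}"

definition schwartz_seminorm :: "nat \<Rightarrow> nat \<Rightarrow> (real \<Rightarrow> complex) \<Rightarrow> real" where
  "schwartz_seminorm k n \<phi> = (SUP x. \<bar>x\<bar> ^ k * norm (higher_vderiv n \<phi> x))"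

text \<open>A tempered distribution is encoded as a functional on all functions, of which only the
  values on Schwartz functions matter. Continuity is expressed by the usual estimate
  against finitely many Schwartz seminorms.\<close>

definition tempered_distribution :: "((real \<Rightarrow> complex) \<Rightarrow> complex) \<Rightarrow> bool" where
  "tempered_distribution T \<longleftrightarrow>
     (\<forall>\<phi>\<in>schwartz. \<forall>\<psi>\<in>schwartz. T (\<lambda>x. \<phi> x + \<psi> x) = T \<phi> + T \<psi>) \<and>
     (\<forall>c. \<forall>\<phi>\<in>schwartz. T (\<lambda>x. c * \<phi> x) = c * T \<phi>) \<and>
     (\<exists>C N. \<forall>\<phi>\<in>schwartz. norm (T \<phi>) \<le> C * (\<Sum>k\<le>N. \<Sum>n\<le>N. schwartz_seminorm k n \<phi>))"

definition fourier :: "(real \<Rightarrow> complex) \<Rightarrow> real \<Rightarrow> complex" where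
  "fourier v p = (LINT x|lborel. v x * exp (- \<i> * of_real (x * p)))"

definition fourier_distr :: "((real \<Rightarrow> complex) \<Rightarrow> complex) \<Rightarrow> (real \<Rightarrow> complex) \<Rightarrow> complex" where
  "fourier_distr T = (\<lambda>\<phi>. T (fourier \<phi>))"

text \<open>\<open>distr_is_L1 T g\<close>: the distribution \<open>T\<close> belongs to \<open>L\<^sup>1\<close>, with representative \<open>g\<close>.\<close>

definition distr_is_L1 :: "((real \<Rightarrow> complex) \<Rightarrow> complex) \<Rightarrow> (real \<Rightarrow> complex) \<Rightarrow> bool" where
  "distr_is_L1 T g \<longleftrightarrow>
     integrable lborel g \<and> (\<forall>\<phi>\<in>schwartz. T \<phi> = (LINT p|lborel. g p * \<phi> p))"

text \<open>The solution of \<open>[i \<partial>\<^sub>t - f(D)] u = 0\<close>, \<open>u(0) = u\<^sub>0\<close>, defined by its explicit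
  formula in terms of \<open>Fu0 = \<F> u\<^sub>0\<close>.\<close>

definition solution :: "(real \<Rightarrow> real) \<Rightarrow> (real \<Rightarrow> complex) \<Rightarrow> real \<Rightarrow> real \<Rightarrow> complex" where
  "solution f Fu0 t x =
     of_real (1 / (2 * pi)) *
       (LINT p|lborel. Fu0 p * exp (\<i> * of_real (- t * f p + x * p)))"

definition spacetime_cone :: "real \<Rightarrow> real \<Rightarrow> (real \<times> real) set" where
  "spacetime_cone a b = {(t, x). 0 < t \<and> a \<le> x / t \<and> x / t \<le> b}"

text \<open>\<open>real_of_ereal\<close> sends infinity to 0; the norm is only used for bounded continuous \<open>g\<close>
  on nonempty open sets, where the essential supremum is finite.\<close>

definition Linf_norm :: "real set \<Rightarrow> (real \<Rightarrow> complex) \<Rightarrow> real" where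
  "Linf_norm S g = real_of_ereal (esssup (restrict_space lborel S) (\<lambda>p. ereal (norm (g p))))"

definition L1_norm :: "real set \<Rightarrow> (real \<Rightarrow> complex) \<Rightarrow> real" where
  "L1_norm S g = (LINT p:S|lborel. norm (g p))"

text \<open>In the constants below, \<open>w\<close> is the regular factor of \<open>\<F> u\<^sub>0\<close> and \<open>w'\<close> its derivative.
  The infimum of \<open>f''\<close> over a compact interval is a minimum, as \<open>f''\<close> is continuous
  wherever the constants are used.\<close>

definition c1_left :: "real \<Rightarrow> real \<Rightarrow> real \<Rightarrow> (real \<Rightarrow> complex) \<Rightarrow> (real \<Rightarrow> complex) \<Rightarrow> (real \<Rightarrow> real) \<Rightarrow> real"
  where
  "c1_left \<eta> \<mu> p1 w w' f =
     1 / (2 * pi) * (3 / \<mu>) * Linf_norm {p1 - \<eta><..<p1} w +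
     1 / pi * (4 * Linf_norm {p1 - \<eta><..<p1} w + L1_norm {p1 - \<eta><..<p1} w') *
       inverse (INF p\<in>{p1 - \<eta>..p1}. deriv (deriv f) p)"

definition c1_right :: "real \<Rightarrow> real \<Rightarrow> real \<Rightarrow> (real \<Rightarrow> complex) \<Rightarrow> (real \<Rightarrow> complex) \<Rightarrow> (real \<Rightarrow> real) \<Rightarrow> real"
  where
  "c1_right \<eta> \<mu> p1 w w' f =
     1 / (2 * pi) * (3 / \<mu>) * Linf_norm {p1<..<p1 + \<eta>} w +
     1 / pi * (4 * Linf_norm {p1<..<p1 + \<eta>} w + L1_norm {p1<..<p1 + \<eta>} w') *
       inverse (INF p\<in>{p1..p1 + \<eta>}. deriv (deriv f) p)"

definition c1 :: "real \<Rightarrow> real \<Rightarrow> real \<Rightarrow> (real \<Rightarrow> complex) \<Rightarrow> (real \<Rightarrow> complex) \<Rightarrow> (real \<Rightarrow> real) \<Rightarrow> real"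
  where
  "c1 \<eta> \<mu> p1 w w' f = c1_left \<eta> \<mu> p1 w w' f + c1_right \<eta> \<mu> p1 w w' f"

definition m_right :: "real \<Rightarrow> real \<Rightarrow> real \<Rightarrow> (real \<Rightarrow> real) \<Rightarrow> real" where
  "m_right \<eta> \<epsilon> p1 f = deriv f (p1 + \<eta>) - deriv f (p1 + \<epsilon>)"

definition m_left :: "real \<Rightarrow> real \<Rightarrow> real \<Rightarrow> (real \<Rightarrow> real) \<Rightarrow> real" where
  "m_left \<eta> \<epsilon> p1 f = deriv f (p1 - \<epsilon>) - deriv f (p1 - \<eta>)"

definition c2 ::
  "real \<Rightarrow> real \<Rightarrow> real \<Rightarrow> real \<Rightarrow> (real \<Rightarrow> complex) \<Rightarrow> (real \<Rightarrow> complex) \<Rightarrow> (real \<Rightarrow> real) \<Rightarrow> real"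
  where
  "c2 \<eta> \<epsilon> \<mu> p1 w w' f =
     1 / (2 * pi) * \<eta> powr (\<mu> - 1) * (4 * Linf_norm UNIV w + L1_norm UNIV w') *
       (inverse (m_right \<eta> \<epsilon> p1 f) + inverse (m_left \<eta> \<epsilon> p1 f))"

end

theory Submission
  imports Defs
begin

text \<open>
  Cut the integral at \<open>p\<^sub>1\<close> and write each half as an integral over \<open>r \<ge> 0\<close>, where \<open>r\<close> is the
  distance to \<open>p\<^sub>1\<close>; in both halves the phase is a convex function of \<open>r\<close>. On an interval where
  the derivative of the phase is monotone and at least \<open>m\<close> in absolute value, one integration by
  parts bounds the integral by a multiple of \<open>1 / m\<close>. For \<open>r \<ge> \<eta>\<close> the cone condition gives
  \<open>m = t (f'(p\<^sub>1 + \<eta>) - f'(p\<^sub>1 + \<epsilon>))\<close>, or its mirror image, hence the \<open>t\<^sup>-\<^sup>1\<close> term. For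
  \<open>r \<le> \<eta>\<close> put \<open>\<delta> = t\<^sup>-\<^sup>1\<^sup>/\<^sup>2\<close>: the \<open>\<delta>\<close>-neighbourhoods of the singularity \<open>r = 0\<close> and of the
  stationary point contribute \<open>O(\<delta>\<^sup>\<mu>)\<close> by size alone, and on the remaining two intervals
  \<open>m = t \<delta> min f''\<close> together with the amplitude bound \<open>r\<^sup>\<mu>\<^sup>-\<^sup>1 \<le> \<delta>\<^sup>\<mu>\<^sup>-\<^sup>1\<close> again gives \<open>O(\<delta>\<^sup>\<mu>)\<close>.
\<close>

section \<open>Integration by parts for an oscillatory integral\<close>

text \<open>With \<open>e = exp (- \<i> \<psi>)\<close> and \<open>G = s / \<psi>'\<close>, the
  product rule for \<open>\<i> G v e\<close> yields the integrand \<open>s v e\<close> plus one term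
  with \<open>v'\<close> and one with \<open>G'\<close>. The two boundary values cost
  \<open>W * s a / m\<close> each, and the variation of \<open>G\<close> is at most
  \<open>2 * s a / m\<close>; together these give the factor 4. The amplitude is split as
  \<open>s v\<close> so that the singular power, which is monotone, can go into \<open>s\<close>,
  while \<open>v\<close> only needs an integrable derivative.\<close>

lemma norm_integral_oscillatory_le:
  fixes v v' :: "real \<Rightarrow> complex" and s s' \<psi> \<psi>' \<psi>'' :: "real \<Rightarrow> real"
  assumes ab: "a \<le> b"
    and v: "\<And>r. r \<in> {a..b} \<Longrightarrow> (v has_vector_derivative v' r) (at r within {a..b})"
    and v': "v' absolutely_integrable_on {a..b}"
    and W: "\<And>r. r \<in> {a..b} \<Longrightarrow> norm (v r) \<le> W"
    and s: "\<And>r. r \<in> {a..b} \<Longrightarrow> (s has_real_derivative s' r) (at r within {a..b})"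
    and s_mono: "\<And>r. r \<in> {a..b} \<Longrightarrow> s' r \<le> 0"
    and s_nonneg: "\<And>r. r \<in> {a..b} \<Longrightarrow> 0 \<le> s r"
    and \<psi>: "\<And>r. r \<in> {a..b} \<Longrightarrow> (\<psi> has_real_derivative \<psi>' r) (at r within {a..b})"
    and \<psi>': "\<And>r. r \<in> {a..b} \<Longrightarrow> (\<psi>' has_real_derivative \<psi>'' r) (at r within {a..b})"
    and \<psi>'': "\<And>r. r \<in> {a..b} \<Longrightarrow> 0 \<le> \<psi>'' r"
    and m: "0 < m"
    and sgn: "(\<forall>r\<in>{a..b}. m \<le> \<psi>' r) \<or> (\<forall>r\<in>{a..b}. \<psi>' r \<le> - m)"
  shows "norm (integral {a..b} (\<lambda>r. of_real (s r) * v r * exp (\<i> * of_real (- \<psi> r))))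
    \<le> s a / m * (4 * W + integral {a..b} (\<lambda>r. norm (v' r)))"
proof -
  let ?S = "{a..b}"
  define e where "e = (\<lambda>r. exp (\<i> * of_real (- \<psi> r)))"
  define G where "G = (\<lambda>r. s r / \<psi>' r)"
  define G' where "G' = (\<lambda>r. (s' r * \<psi>' r - s r * \<psi>'' r) / (\<psi>' r * \<psi>' r))"
  have ne: "\<psi>' r \<noteq> 0" and abs_m: "m \<le> \<bar>\<psi>' r\<bar>" if "r \<in> ?S" for r
    using sgn that m by force+
  have norm_e: "norm (e r) = 1" for r
    unfolding e_def by simp
  have dG: "(G has_real_derivative G' r) (at r within ?S)" if "r \<in> ?S" for r
    unfolding G_def G'_def using DERIV_divide[OF s[OF that] \<psi>'[OF that] ne[OF that]] .
  have de: "(e has_vector_derivative - \<i> * of_real (\<psi>' r) * e r) (at r within ?S)" if "r \<in> ?S" for r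
  proof -
    have "((\<lambda>r. \<i> * of_real (- \<psi> r)) has_vector_derivative \<i> * of_real (- \<psi>' r)) (at r within ?S)"
      using \<psi>[OF that]
      by (auto intro!: derivative_eq_intros simp: has_real_derivative_iff_has_vector_derivative)
    from field_vector_diff_chain_within[OF this DERIV_subset[OF DERIV_exp subset_UNIV]]
    show ?thesis unfolding e_def o_def by simp
  qed
  have dP: "((\<lambda>r. \<i> * of_real (G r) * (v r * e r)) has_vector_derivative
      \<i> * of_real (G r) * (v' r * e r) + \<i> * of_real (G' r) * (v r * e r)
        + of_real (s r) * v r * e r) (at r within ?S)" if "r \<in> ?S" for r
  proof -
    have "((\<lambda>r. \<i> * of_real (G r)) has_vector_derivative \<i> * of_real (G' r)) (at r within ?S)"
      using dG[OF that]
      by (auto intro!: derivative_eq_intros simp: has_real_derivative_iff_has_vector_derivative)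
    from has_vector_derivative_mult[OF this has_vector_derivative_mult[OF v[OF that] de[OF that]]]
    show ?thesis
      by (rule has_vector_derivative_eq_rhs)
         (use ne[OF that] in \<open>simp add: G_def field_simps\<close>)
  qed
  have cont_v: "continuous_on ?S v"
    unfolding continuous_on_eq_continuous_within
    using has_vector_derivative_continuous[OF v] by blast
  have cont_e: "continuous_on ?S e"
    unfolding continuous_on_eq_continuous_within
    using has_vector_derivative_continuous[OF de] by blast
  have cont_s: "continuous_on ?S s"
    by (rule DERIV_continuous_on) (rule s)
  have cont_G: "continuous_on ?S G"
    by (rule DERIV_continuous_on) (rule dG)
  have i1: "(\<lambda>r. of_real (s r) * v r * e r) integrable_on ?S"
    by (intro integrable_continuous_interval continuous_intros cont_v cont_e cont_s)
  have abs2: "(\<lambda>r. (\<i> * of_real (G r) * e r) * v' r) absolutely_integrable_on ?S"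
  proof (rule absolutely_integrable_bounded_measurable_product[OF bilinear_times _ _ _ v'])
    have c: "continuous_on ?S (\<lambda>r. \<i> * of_real (G r) * e r)"
      by (intro continuous_intros cont_G cont_e)
    show "(\<lambda>r. \<i> * of_real (G r) * e r) \<in> borel_measurable (lebesgue_on ?S)"
      by (rule continuous_imp_measurable_on_sets_lebesgue[OF c]) auto
    show "bounded ((\<lambda>r. \<i> * of_real (G r) * e r) ` ?S)"
      by (intro compact_imp_bounded compact_continuous_image c) auto
  qed auto
  have i2: "(\<lambda>r. \<i> * of_real (G r) * (v' r * e r)) integrable_on ?S"
    using set_lebesgue_integral_eq_integral(1)[OF abs2] by (simp add: mult_ac)
  have ftc: "((\<lambda>r. \<i> * of_real (G r) * (v' r * e r) + \<i> * of_real (G' r) * (v r * e r)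
        + of_real (s r) * v r * e r) has_integral
      (\<i> * of_real (G b) * (v b * e b) - \<i> * of_real (G a) * (v a * e a))) ?S"
    by (rule fundamental_theorem_of_calculus[OF ab dP])
  \<comment> \<open>Neither \<open>s'\<close> nor \<open>\<psi>''\<close> is assumed continuous or
    integrable. Integrability of this term follows by subtraction: the full derivative is integrable
    by the fundamental theorem, and so are the other two summands.\<close>
  have i3: "(\<lambda>r. \<i> * of_real (G' r) * (v r * e r)) integrable_on ?S"
    using integrable_diff[OF integrable_diff[OF has_integral_integrable[OF ftc] i1] i2] by simp
  have eq: "integral ?S (\<lambda>r. of_real (s r) * v r * e r) =
      (\<i> * of_real (G b) * (v b * e b) - \<i> * of_real (G a) * (v a * e a))
      - integral ?S (\<lambda>r. \<i> * of_real (G r) * (v' r * e r))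
      - integral ?S (\<lambda>r. \<i> * of_real (G' r) * (v r * e r))"
    using integral_unique[OF ftc] i1 i2 i3
    by (simp add: integral_add integrable_add algebra_simps)
  have s_le: "s r \<le> s a" if "r \<in> ?S" for r
  proof -
    have "((\<lambda>x. s' x) has_integral (s r - s a)) {a..r}"
    proof (rule fundamental_theorem_of_calculus)
      fix x assume "x \<in> {a..r}"
      thus "(s has_vector_derivative s' x) (at x within {a..r})"
        using that DERIV_subset[OF s, of x "{a..r}"]
        by (simp add: has_real_derivative_iff_has_vector_derivative)
    qed (use that in simp)
    from has_integral_neg[OF this] have "0 \<le> - (s r - s a)"
      by (rule has_integral_nonneg) (use s_mono that in auto)
    thus ?thesis by simp
  qed
  have G_le: "\<bar>G r\<bar> \<le> s a / m" if "r \<in> ?S" for r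
    unfolding G_def abs_divide
    by (rule frac_le) (use s_le[OF that] s_nonneg[OF that] abs_m[OF that] m in auto)
  have aS: "a \<in> ?S" and bS: "b \<in> ?S" using ab by auto
  have W0: "0 \<le> W" using W[OF aS] norm_ge_zero order_trans by blast
  have bdry: "norm (\<i> * of_real (G r) * (v r * e r)) \<le> s a / m * W" if "r \<in> ?S" for r
    using mult_mono[OF G_le[OF that] W[OF that]] G_le[OF that]
    by (simp add: norm_mult norm_e)
  have n2: "norm (integral ?S (\<lambda>r. \<i> * of_real (G r) * (v' r * e r)))
      \<le> s a / m * integral ?S (\<lambda>r. norm (v' r))"
  proof -
    have nv': "(\<lambda>r. norm (v' r)) integrable_on ?S"
      using v' by (simp add: absolutely_integrable_on_def)
    have snv': "(\<lambda>r. s a / m * norm (v' r)) integrable_on ?S"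
      using integrable_on_cmult_left[OF nv', of "s a / m"] by simp
    have "norm (integral ?S (\<lambda>r. \<i> * of_real (G r) * (v' r * e r)))
        \<le> integral ?S (\<lambda>r. s a / m * norm (v' r))"
      by (rule integral_norm_bound_integral[OF i2 snv'])
         (simp add: norm_mult norm_e G_le mult_right_mono del: times_divide_eq_left)
    thus ?thesis by simp
  qed
  \<comment> \<open>\<open>D'\<close> dominates \<open>W * \<bar>G'\<bar>\<close> pointwise, so that \<open>G'\<close> need not be of one sign.\<close>
  define D where "D = (\<lambda>r. - W * (s r / m + s a / \<psi>' r))"
  have dD: "(D has_vector_derivative W * (- s' r / m + s a * \<psi>'' r / (\<psi>' r * \<psi>' r)))
      (at r within ?S)" if "r \<in> ?S" for r
    unfolding D_def has_real_derivative_iff_has_vector_derivative[symmetric]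
    using s[OF that] \<psi>'[OF that] ne[OF that] m
    by (auto intro!: derivative_eq_intros simp: field_simps)
  have n3: "norm (integral ?S (\<lambda>r. \<i> * of_real (G' r) * (v r * e r))) \<le> D b - D a"
  proof -
    note ftc_D = fundamental_theorem_of_calculus[OF ab dD]
    have "norm (integral ?S (\<lambda>r. \<i> * of_real (G' r) * (v r * e r)))
      \<le> integral ?S (\<lambda>r. W * (- s' r / m + s a * \<psi>'' r / (\<psi>' r * \<psi>' r)))"
    proof (rule integral_norm_bound_integral[OF i3 has_integral_integrable[OF ftc_D]])
      fix r assume r: "r \<in> ?S"
      have "\<bar>G' r\<bar> = \<bar>s' r / \<psi>' r - s r * \<psi>'' r / (\<psi>' r * \<psi>' r)\<bar>"
        unfolding G'_def using ne[OF r] by (simp add: field_simps)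
      also have "\<dots> \<le> \<bar>s' r / \<psi>' r\<bar> + \<bar>s r * \<psi>'' r / (\<psi>' r * \<psi>' r)\<bar>"
        by (rule abs_triangle_ineq4)
      also have "\<bar>s' r / \<psi>' r\<bar> \<le> - s' r / m"
        using s_mono[OF r] abs_m[OF r] m unfolding abs_divide by (intro frac_le) auto
      also have "\<bar>s r * \<psi>'' r / (\<psi>' r * \<psi>' r)\<bar> = s r * \<psi>'' r / (\<psi>' r * \<psi>' r)"
        using s_nonneg[OF r] \<psi>''[OF r] by (intro abs_of_nonneg) simp
      also have "\<dots> \<le> s a * \<psi>'' r / (\<psi>' r * \<psi>' r)"
        using s_le[OF r] \<psi>''[OF r] by (intro divide_right_mono mult_right_mono) auto
      finally have *: "\<bar>G' r\<bar> \<le> - s' r / m + s a * \<psi>'' r / (\<psi>' r * \<psi>' r)" by simp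
      have "norm (\<i> * of_real (G' r) * (v r * e r)) = norm (v r) * \<bar>G' r\<bar>"
        by (simp add: norm_mult norm_e)
      also have "\<dots> \<le> W * (- s' r / m + s a * \<psi>'' r / (\<psi>' r * \<psi>' r))"
        by (rule mult_mono[OF W[OF r] * W0]) simp
      finally show "norm (\<i> * of_real (G' r) * (v r * e r))
          \<le> W * (- s' r / m + s a * \<psi>'' r / (\<psi>' r * \<psi>' r))" .
    qed
    thus ?thesis using integral_unique[OF ftc_D] by simp
  qed
  \<comment> \<open>Only one of the two terms counts: for positive \<open>\<psi>'\<close> the
    subtracted one helps, for negative \<open>\<psi>'\<close> the first one does.\<close>
  have "1 / \<psi>' a - 1 / \<psi>' b \<le> 1 / m"
  proof (rule disjE[OF sgn])
    assume "\<forall>r\<in>?S. m \<le> \<psi>' r"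
    hence "0 < \<psi>' b" "m \<le> \<psi>' a" using aS bS m by force+
    hence "0 \<le> 1 / \<psi>' b" "1 / \<psi>' a \<le> 1 / m" using m by (auto intro!: frac_le)
    thus ?thesis by linarith
  next
    assume "\<forall>r\<in>?S. \<psi>' r \<le> - m"
    hence "\<psi>' a < 0" "m \<le> - \<psi>' b" using aS bS m by force+
    from this have "1 / (- \<psi>' b) \<le> 1 / m" using m by (intro frac_le) auto
    hence "- (1 / \<psi>' b) \<le> 1 / m" by simp
    moreover have "1 / \<psi>' a \<le> 0" using \<open>\<psi>' a < 0\<close> by simp
    ultimately show ?thesis by linarith
  qed
  from mult_left_mono[OF this s_nonneg[OF aS]]
  have "s a / \<psi>' a - s a / \<psi>' b \<le> s a / m" by (simp add: right_diff_distrib)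
  moreover have "s a / m - s b / m \<le> s a / m" using s_nonneg[OF bS] m by simp
  ultimately have "(s a / m - s b / m) + (s a / \<psi>' a - s a / \<psi>' b) \<le> 2 * (s a / m)" by linarith
  from mult_left_mono[OF this W0] have "D b - D a \<le> s a / m * (2 * W)"
    unfolding D_def by (simp add: algebra_simps)
  with n3 have n3': "norm (integral ?S (\<lambda>r. \<i> * of_real (G' r) * (v r * e r))) \<le> s a / m * (2 * W)"
    by linarith
  have "norm (integral ?S (\<lambda>r. of_real (s r) * v r * e r))
      \<le> (s a / m * W + s a / m * W) + s a / m * integral ?S (\<lambda>r. norm (v' r)) + s a / m * (2 * W)"
    unfolding eq
    by (rule order_trans[OF norm_triangle_ineq4] add_mono bdry aS bS n2 n3')+
  thus ?thesis unfolding e_def by (simp add: algebra_simps)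
qed

section \<open>Convex phase on a half-line with an amplitude singular at the origin\<close>

text \<open>Here \<open>r\<close> is the distance to the singular point, and time and position are
  absorbed into the phase \<open>\<psi>\<close>. Reflection preserves convexity, so both halves of
  the line are instances.\<close>

locale half_line_phase =
  fixes \<mu> :: real and v v' :: "real \<Rightarrow> complex" and \<psi> \<psi>' \<psi>'' :: "real \<Rightarrow> real"
  assumes \<mu>_pos: "0 < \<mu>" and \<mu>_le: "\<mu> \<le> 1"
    and v: "\<And>r. (v has_vector_derivative v' r) (at r)"
    and v': "integrable lborel v'"
    and \<psi>: "\<And>r. (\<psi> has_real_derivative \<psi>' r) (at r)"
    and \<psi>': "\<And>r. (\<psi>' has_real_derivative \<psi>'' r) (at r)"
    and \<psi>''_nonneg: "\<And>r. 0 \<le> \<psi>'' r"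
begin

text \<open>In HOL \<open>0 powr (\<mu> - 1) = 0\<close>, so \<open>F 0 = 0\<close> and pointwise
  bounds by \<open>r powr (\<mu> - 1)\<close> remain true at the singular point.\<close>

definition F :: "real \<Rightarrow> complex" where
  "F r = of_real (r powr (\<mu> - 1)) * v r * exp (\<i> * of_real (- \<psi> r))"

lemma norm_F: "norm (F r) = r powr (\<mu> - 1) * norm (v r)"
  by (simp add: F_def norm_mult)

lemma continuous_on_v: "continuous_on S v"
  by (meson v continuous_at_imp_continuous_on has_vector_derivative_continuous)

lemma continuous_on_\<psi>: "continuous_on S \<psi>"
  by (meson \<psi> continuous_at_imp_continuous_on DERIV_isCont)

lemma continuous_on_\<psi>': "continuous_on S \<psi>'"
  by (meson \<psi>' continuous_at_imp_continuous_on DERIV_isCont)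

lemma borel_measurable_F: "F \<in> borel_measurable borel"
proof -
  have [measurable]: "v \<in> borel_measurable borel" "\<psi> \<in> borel_measurable borel"
    by (intro borel_measurable_continuous_onI continuous_on_v continuous_on_\<psi>)+
  show ?thesis unfolding F_def by measurable
qed

lemma norm_v'_integrable_on: "(\<lambda>r. norm (v' r)) integrable_on {a..b}"
proof -
  have "integrable lborel (\<lambda>r. norm (v' r))" using v' by simp
  hence "(\<lambda>r. norm (v' r)) integrable_on UNIV"
    by (rule integrable_on_lborel)
  thus ?thesis by (rule integrable_on_subinterval) auto
qed

lemma v'_absolutely_integrable_on: "v' absolutely_integrable_on {a..b}"
proof -
  have "v' integrable_on UNIV" using v' by (rule integrable_on_lborel)
  hence "v' integrable_on {a..b}" by (rule integrable_on_subinterval) auto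
  thus ?thesis using norm_v'_integrable_on by (simp add: absolutely_integrable_on_def)
qed

text \<open>Integration by parts with \<open>s r = r powr (\<mu> - 1)\<close>, which is
  nonincreasing because \<open>\<mu> \<le> 1\<close> and differentiable because
  \<open>a > 0\<close>. The total variation of \<open>v\<close> is replaced by a bound
  \<open>N\<close> so that one constant can serve several subintervals.\<close>

lemma norm_integral_F_nonstationary_le:
  assumes "0 < a" "a \<le> b" "0 < m"
    and W: "\<And>r. r \<in> {a..b} \<Longrightarrow> norm (v r) \<le> W"
    and N: "integral {a..b} (\<lambda>r. norm (v' r)) \<le> N"
    and sgn: "(\<forall>r\<in>{a..b}. m \<le> \<psi>' r) \<or> (\<forall>r\<in>{a..b}. \<psi>' r \<le> - m)"
  shows "norm (integral {a..b} F) \<le> a powr (\<mu> - 1) / m * (4 * W + N)"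
proof -
  have "norm (integral {a..b} F)
      \<le> a powr (\<mu> - 1) / m * (4 * W + integral {a..b} (\<lambda>r. norm (v' r)))"
    unfolding F_def
  proof (rule norm_integral_oscillatory_le)
    show "((\<lambda>r. r powr (\<mu> - 1)) has_real_derivative (\<mu> - 1) * r powr (\<mu> - 2)) (at r within {a..b})"
      if "r \<in> {a..b}" for r
      using that assms(1) by (auto intro!: derivative_eq_intros)
    show "(\<mu> - 1) * r powr (\<mu> - 2) \<le> 0" for r
      using \<mu>_le by (simp add: mult_nonpos_nonneg)
    show "(v has_vector_derivative v' r) (at r within {a..b})" for r
      by (rule has_vector_derivative_at_within[OF v])
    show "(\<psi> has_real_derivative \<psi>' r) (at r within {a..b})" for r
      by (rule has_field_derivative_at_within[OF \<psi>])
    show "(\<psi>' has_real_derivative \<psi>'' r) (at r within {a..b})" for r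
      by (rule has_field_derivative_at_within[OF \<psi>'])
  qed (use assms \<psi>''_nonneg v'_absolutely_integrable_on in simp_all)
  also have "\<dots> \<le> a powr (\<mu> - 1) / m * (4 * W + N)"
    using N \<open>0 < m\<close> by (intro mult_left_mono) auto
  finally show ?thesis .
qed

lemma \<psi>'_mono: "x \<le> y \<Longrightarrow> \<psi>' x \<le> \<psi>' y"
  by (rule DERIV_nonneg_imp_nondecreasing) (use \<psi>' \<psi>''_nonneg in blast)+

text \<open>Used to turn the distance from the stationary point into a lower bound for the absolute
  value of \<open>\<psi>'\<close>.\<close>

lemma \<psi>'_diff_ge:
  assumes "x \<le> y" and "\<And>r. r \<in> {x..y} \<Longrightarrow> K \<le> \<psi>'' r"
  shows "K * (y - x) \<le> \<psi>' y - \<psi>' x"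
proof -
  have "\<psi>' x - K * x \<le> \<psi>' y - K * y"
  proof (rule DERIV_nonneg_imp_nondecreasing[OF assms(1)])
    fix r assume "x \<le> r" "r \<le> y"
    with assms(2)[of r]
    show "\<exists>D. ((\<lambda>r. \<psi>' r - K * r) has_real_derivative D) (at r) \<and> 0 \<le> D"
      by (intro exI[of _ "\<psi>'' r - K"]) (auto intro!: derivative_eq_intros \<psi>')
  qed
  thus ?thesis by (simp add: algebra_simps)
qed

lemma norm_integral_F_near_0_le:
  assumes "0 \<le> c" and "F integrable_on {0..c}" and W: "\<And>r. r \<in> {0..c} \<Longrightarrow> norm (v r) \<le> W"
  shows "norm (integral {0..c} F) \<le> W * (c powr \<mu> / \<mu>)"
proof -
  have hi: "((\<lambda>r. W * r powr (\<mu> - 1)) has_integral W * (c powr \<mu> / \<mu>)) {0..c}"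
    using has_integral_mult_right[OF has_integral_powr_from_0[of "\<mu> - 1" c], of W] assms(1) \<mu>_pos
    by simp
  have "norm (integral {0..c} F) \<le> integral {0..c} (\<lambda>r. W * r powr (\<mu> - 1))"
  proof (rule integral_norm_bound_integral[OF assms(2)])
    show "(\<lambda>r. W * r powr (\<mu> - 1)) integrable_on {0..c}"
      using hi by blast
    fix r assume "r \<in> {0..c}"
    from mult_right_mono[OF W[OF this], of "r powr (\<mu> - 1)"]
    show "norm (F r) \<le> W * r powr (\<mu> - 1)" by (simp add: norm_F mult.commute)
  qed
  thus ?thesis unfolding integral_unique[OF hi] .
qed

text \<open>The windows at the origin and at the stationary point account for
  \<open>3 / \<mu> * W\<close>: once for the first, twice for the second, whose length is at most
  \<open>2 * \<delta>\<close>. The two intervals between and beyond the windows account for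
  \<open>2 * (4 * W + N) / k\<close>.\<close>

lemma norm_integral_F_stationary_le:
  assumes \<eta>: "0 < \<eta>" and k: "0 < k" and t: "0 < t"
    and \<psi>''_ge: "\<And>r. r \<in> {0..\<eta>} \<Longrightarrow> t * k \<le> \<psi>'' r"
    and \<psi>'_\<eta>: "0 \<le> \<psi>' \<eta>"
    and W: "\<And>r. r \<in> {0..\<eta>} \<Longrightarrow> norm (v r) \<le> W"
    and N: "integral {0..\<eta>} (\<lambda>r. norm (v' r)) \<le> N"
    and int: "F integrable_on {0..\<eta>}"
  shows "norm (integral {0..\<eta>} F) \<le> (3 / \<mu> * W + 2 * (4 * W + N) / k) * t powr (- \<mu> / 2)"
proof -
  \<comment> \<open>This choice balances the window size \<open>\<delta> powr \<mu>\<close> against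
    \<open>\<delta> powr (\<mu> - 1) / (t * k * \<delta>)\<close> from integration by parts: the two
    agree up to constants exactly when \<open>t * \<delta> * \<delta> = 1\<close>.\<close>
  define \<delta> where "\<delta> = t powr (- 1 / 2)"
  have \<delta>: "0 < \<delta>" unfolding \<delta>_def using t by simp
  have \<delta>_sq: "t * \<delta> * \<delta> = 1"
  proof -
    have "\<delta> * \<delta> = t powr - 1" unfolding \<delta>_def by (simp flip: powr_add)
    thus ?thesis using t by (simp add: powr_minus field_simps)
  qed
  have \<delta>_\<mu>: "\<delta> powr \<mu> = t powr (- \<mu> / 2)"
    unfolding \<delta>_def by (simp add: powr_powr)
  have \<delta>_\<mu>1: "\<delta> powr (\<mu> - 1) = \<delta> powr \<mu> / \<delta>"
    using \<delta> by (simp add: powr_diff)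
  define T where "T = \<delta> powr \<mu>"
  have T0: "0 < T" unfolding T_def using \<delta> by simp
  have W0: "0 \<le> W"
    by (rule order_trans[OF norm_ge_zero W[of 0]]) (use \<eta> in simp)
  have N0: "0 \<le> N"
    using N integral_nonneg[OF norm_v'_integrable_on, of 0 \<eta>] by simp
  define R where "R = W * T / \<mu>"
  define Q where "Q = T / k * (4 * W + N)"
  have R0: "0 \<le> R" and Q0: "0 \<le> Q"
    unfolding R_def Q_def using W0 N0 T0 \<mu>_pos k by auto
  have int': "F integrable_on {a..b}" if "0 \<le> a" "b \<le> \<eta>" for a b
    by (rule integrable_on_subinterval[OF int]) (use that in auto)
  have N': "integral {a..b} (\<lambda>r. norm (v' r)) \<le> N" if "0 \<le> a" "b \<le> \<eta>" for a b
  proof -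
    have "integral {a..b} (\<lambda>r. norm (v' r)) \<le> integral {0..\<eta>} (\<lambda>r. norm (v' r))"
      by (rule integral_subset_le) (use that norm_v'_integrable_on in auto)
    with N show ?thesis by linarith
  qed
  have start: "norm (integral {0..c} F) \<le> R" if "0 \<le> c" "c \<le> \<delta>" "c \<le> \<eta>" for c
  proof -
    have "norm (integral {0..c} F) \<le> W * (c powr \<mu> / \<mu>)"
      by (rule norm_integral_F_near_0_le) (use that W int' in auto)
    also have "\<dots> \<le> W * (T / \<mu>)"
      unfolding T_def using that \<mu>_pos W0
      by (intro mult_left_mono divide_right_mono powr_mono2) auto
    finally show ?thesis unfolding R_def by simp
  qed
  have "norm (integral {0..\<eta>} F) \<le> 3 * (R) + 2 * (Q)"
  \<comment> \<open>For small times the window at the origin already covers the whole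
    interval.\<close>
  proof (cases "\<eta> \<le> \<delta>")
    case True
    with start[of \<eta>] \<eta> R0 Q0 show ?thesis by linarith
  next
    case False
    hence \<delta>\<eta>: "\<delta> < \<eta>" by simp
    \<comment> \<open>\<open>q\<close> is the stationary point, replaced by \<open>0\<close> if the phase is already increasing there.\<close>
    obtain q where q: "0 \<le> q" "q \<le> \<eta>" "0 \<le> \<psi>' q" "0 < q \<Longrightarrow> \<psi>' q = 0"
    proof (cases "0 \<le> \<psi>' 0")
      case True
      thus ?thesis using that[of 0] \<eta> by simp
    next
      case False
      with IVT'[of \<psi>' 0 0 \<eta>, OF _ \<psi>'_\<eta> _ continuous_on_\<psi>'] \<eta>
      obtain x where "0 \<le> x" "x \<le> \<eta>" "\<psi>' x = 0"
        by auto
      thus ?thesis using that[of x] by simp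
    qed
    have slope: "t * k * (y - x) \<le> \<psi>' y - \<psi>' x" if "0 \<le> x" "x \<le> y" "y \<le> \<eta>" for x y
      by (rule \<psi>'_diff_ge) (use that \<psi>''_ge in auto)
    \<comment> \<open>\<open>{a..b}\<close> is the window of radius \<open>\<delta>\<close> around
      \<open>q\<close>, clipped to \<open>{\<delta>..\<eta>}\<close>. Where clipping is effective,
      the adjacent outer interval shrinks to a point.\<close>
    define a where "a = max \<delta> (q - \<delta>)"
    define b where "b = min \<eta> (q + \<delta>)"
    have ab: "\<delta> \<le> a" "a \<le> b" "b \<le> \<eta>" "b - a \<le> 2 * \<delta>"
      unfolding a_def b_def using \<delta> \<delta>\<eta> q by auto
    have m: "0 < t * k * \<delta>" using t k \<delta> by simp
    have far: "norm (integral {c..d} F) \<le> Q"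
      if "\<delta> \<le> c" "c \<le> d" "d \<le> \<eta>"
        "(\<forall>r\<in>{c..d}. t * k * \<delta> \<le> \<psi>' r) \<or> (\<forall>r\<in>{c..d}. \<psi>' r \<le> - (t * k * \<delta>))" for c d
    proof -
      have "norm (integral {c..d} F) \<le> c powr (\<mu> - 1) / (t * k * \<delta>) * (4 * W + N)"
        by (rule norm_integral_F_nonstationary_le) (use that m W N' \<delta> in auto)
      also have "\<dots> \<le> \<delta> powr (\<mu> - 1) / (t * k * \<delta>) * (4 * W + N)"
        using that \<delta> m W0 N0 \<mu>_le
        by (intro mult_right_mono divide_right_mono powr_mono2') auto
      also have "\<delta> powr (\<mu> - 1) / (t * k * \<delta>) = T / (k * (t * \<delta> * \<delta>))"
        unfolding \<delta>_\<mu>1 T_def by (simp add: mult_ac)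
      also have "\<dots> = T / k" unfolding \<delta>_sq by simp
      finally show ?thesis unfolding Q_def .
    qed
    have J1: "norm (integral {\<delta>..a} F) \<le> Q"
    proof (cases "a = \<delta>")
      case True
      thus ?thesis using Q0 by simp
    next
      case False
      \<comment> \<open>A nondegenerate left interval forces \<open>q > 0\<close>, so
        \<open>q\<close> is a genuine stationary point and \<open>\<psi>'\<close> is negative to its
        left.\<close>
      hence a: "a = q - \<delta>" "\<delta> < a" unfolding a_def by auto
      hence "\<psi>' q = 0" using q \<delta> by simp
      have "\<psi>' r \<le> - (t * k * \<delta>)" if "r \<in> {\<delta>..a}" for r
      proof -
        have "t * k * \<delta> \<le> t * k * (q - r)" using that a t k by (intro mult_left_mono) auto
        also have "\<dots> \<le> \<psi>' q - \<psi>' r" by (rule slope) (use that a \<delta> q in auto)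
        finally show ?thesis using \<open>\<psi>' q = 0\<close> by simp
      qed
      thus ?thesis by (intro far) (use ab in auto)
    qed
    have J3: "norm (integral {b..\<eta>} F) \<le> Q"
    proof (cases "b = \<eta>")
      case True
      thus ?thesis using Q0 by simp
    next
      case False
      hence b: "b = q + \<delta>" unfolding b_def by auto
      \<comment> \<open>To the right of \<open>q\<close>, \<open>0 \<le> \<psi>' q\<close> suffices,
        so a phase already increasing at 0 needs no separate treatment.\<close>
      have "t * k * \<delta> \<le> \<psi>' r" if "r \<in> {b..\<eta>}" for r
      proof -
        have "t * k * \<delta> \<le> t * k * (r - q)" using that b t k by (intro mult_left_mono) auto
        also have "\<dots> \<le> \<psi>' r - \<psi>' q" by (rule slope) (use that b \<delta> q in auto)
        finally show ?thesis using q by simp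
      qed
      thus ?thesis by (intro far) (use ab in auto)
    qed
    have J2: "norm (integral {a..b} F) \<le> 2 * (R)"
    proof -
      have "norm (integral {a..b} F) \<le> integral {a..b} (\<lambda>r. \<delta> powr (\<mu> - 1) * W)"
      proof (rule integral_norm_bound_integral)
        fix r assume "r \<in> {a..b}"
        thus "norm (F r) \<le> \<delta> powr (\<mu> - 1) * W"
          unfolding norm_F using ab \<delta> \<mu>_le W by (intro mult_mono powr_mono2') auto
      qed (use ab \<delta> int' in auto)
      also have "\<dots> = (b - a) * (\<delta> powr (\<mu> - 1) * W)" using ab by simp
      also have "\<dots> \<le> (2 * \<delta>) * (\<delta> powr (\<mu> - 1) * W)"
        using ab W0 by (intro mult_right_mono) auto
      also have "\<dots> = 2 * (W * T)" unfolding \<delta>_\<mu>1 T_def using \<delta> by simp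
      \<comment> \<open>A factor \<open>1 / \<mu> \<ge> 1\<close> is given away here so that both
        windows combine into a single multiple of \<open>1 / \<mu>\<close>.\<close>
      also have "W * T \<le> R"
        unfolding R_def using W0 T0 \<mu>_pos \<mu>_le by (simp add: pos_le_divide_eq mult_left_le)
      finally show ?thesis by simp
    qed
    have "integral {0..\<eta>} F = integral {0..\<delta>} F + integral {\<delta>..\<eta>} F"
      by (rule Henstock_Kurzweil_Integration.integral_combine[symmetric]) (use \<delta> \<delta>\<eta> int in auto)
    also have "integral {\<delta>..\<eta>} F = integral {\<delta>..a} F + integral {a..\<eta>} F"
      by (rule Henstock_Kurzweil_Integration.integral_combine[symmetric]) (use ab \<delta> int' in auto)
    also have "integral {a..\<eta>} F = integral {a..b} F + integral {b..\<eta>} F"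
      by (rule Henstock_Kurzweil_Integration.integral_combine[symmetric]) (use ab \<delta> int' in auto)
    finally have "norm (integral {0..\<eta>} F) \<le> norm (integral {0..\<delta>} F)
        + (norm (integral {\<delta>..a} F) + (norm (integral {a..b} F) + norm (integral {b..\<eta>} F)))"
      by (simp add: norm_triangle_mono)
    with J1 J2 J3 start[of \<delta>] \<delta> \<delta>\<eta> show ?thesis by linarith
  qed
  also have "\<dots> = (3 / \<mu> * W + 2 * (4 * W + N) / k) * T"
    unfolding R_def Q_def by (simp add: algebra_simps add_divide_distrib)
  also have "T = t powr (- \<mu> / 2)" unfolding T_def by (rule \<delta>_\<mu>)
  finally show ?thesis .
qed

text \<open>Since \<open>\<psi>'\<close> is nondecreasing, the bound \<open>M\<close> at
  \<open>\<eta>\<close> persists on all of \<open>{\<eta>..b}\<close>. The resulting estimate does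
  not depend on \<open>b\<close>, so it passes to the limit, and integrability of \<open>F\<close>
  identifies that limit as the half-line integral.\<close>

lemma norm_integral_F_half_line_le:
  assumes \<eta>: "0 < \<eta>" and k: "0 < k" and t: "0 < t" and M: "0 < M"
    and \<psi>''_ge: "\<And>r. r \<in> {0..\<eta>} \<Longrightarrow> t * k \<le> \<psi>'' r"
    and \<psi>'_\<eta>: "M \<le> \<psi>' \<eta>"
    and W: "\<And>r. r \<in> {0..\<eta>} \<Longrightarrow> norm (v r) \<le> W"
    and N: "(LINT r:{0..\<eta>}|lborel. norm (v' r)) \<le> N"
    and W': "\<And>r. norm (v r) \<le> W'"
    and N': "(LINT r|lborel. norm (v' r)) \<le> N'"
    and int: "set_integrable lborel {0..} F"
  shows "norm (LINT r:{0..}|lborel. F r)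
    \<le> (3 / \<mu> * W + 2 * (4 * W + N) / k) * t powr (- \<mu> / 2) + \<eta> powr (\<mu> - 1) / M * (4 * W' + N')"
    (is "_ \<le> ?B")
proof -
  have int': "set_integrable lborel {0..b} F" for b
    by (rule set_integrable_subset[OF int]) auto
  note eqF = set_borel_integral_eq_integral[OF int']
  have sv': "set_integrable lborel S (\<lambda>r. norm (v' r))" if "S \<in> sets lborel" for S
    unfolding set_integrable_def using v' that
    by (intro integrable_mult_indicator) auto
  have I: "(LINT r:{a..b}|lborel. norm (v' r)) = integral {a..b} (\<lambda>r. norm (v' r))" for a b
    by (rule set_borel_integral_eq_integral(2)[OF sv']) simp
  have near: "norm (integral {0..\<eta>} F)
      \<le> (3 / \<mu> * W + 2 * (4 * W + N) / k) * t powr (- \<mu> / 2)"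
    by (rule norm_integral_F_stationary_le) (use assms eqF I in auto)
  have far: "norm (integral {\<eta>..b} F) \<le> \<eta> powr (\<mu> - 1) / M * (4 * W' + N')" if "\<eta> \<le> b" for b
  proof (rule norm_integral_F_nonstationary_le)
    have "integral {\<eta>..b} (\<lambda>r. norm (v' r)) \<le> (LINT r|lborel. norm (v' r))"
      unfolding I[symmetric] set_lebesgue_integral_def
      using v' sv'[of "{\<eta>..b}"]
      by (intro integral_mono) (auto simp: set_integrable_def indicator_def)
    with N' show "integral {\<eta>..b} (\<lambda>r. norm (v' r)) \<le> N'" by simp
    show "(\<forall>r\<in>{\<eta>..b}. M \<le> \<psi>' r) \<or> (\<forall>r\<in>{\<eta>..b}. \<psi>' r \<le> - M)"
      using \<psi>'_mono \<psi>'_\<eta> by force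
  qed (use assms that in auto)
  have "norm (LINT r:{0..b}|lborel. F r) \<le> ?B" if "\<eta> \<le> b" for b
  proof -
    have "integral {0..b} F = integral {0..\<eta>} F + integral {\<eta>..b} F"
      by (rule Henstock_Kurzweil_Integration.integral_combine[symmetric]) (use \<eta> that eqF in auto)
    thus ?thesis unfolding eqF(2)
      using norm_triangle_mono[OF near far[OF that]] by simp
  qed
  hence "\<forall>\<^sub>F b in at_top. norm (LINT r:{0..b}|lborel. F r) \<le> ?B"
    using eventually_ge_at_top[of \<eta>] by (rule eventually_mono[rotated]) auto
  moreover have "((\<lambda>b. LINT r:{0..b}|lborel. F r) \<longlongrightarrow> (LINT r:{0..}|lborel. F r)) at_top"
    by (rule tendsto_set_lebesgue_integral_at_top) (use int' int in auto)
  ultimately show ?thesis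
    by (intro tendsto_upperbound[OF tendsto_norm]) auto
qed

end

section \<open>Essential suprema and integral norms of the regular factor\<close>

text \<open>By continuity the set where the essential supremum bounds \<open>norm (g p)\<close> is
  closed; as it contains almost every point of the open set \<open>S\<close>, it contains all of
  \<open>S\<close>.\<close>

lemma norm_le_Linf_norm:
  assumes "open S" and g: "continuous_on UNIV g" and bdd: "bounded (range g)" and "p \<in> S"
  shows "norm (g p) \<le> Linf_norm S g"
proof -
  let ?M = "restrict_space lborel S" and ?h = "\<lambda>p. ereal (norm (g p))"
  define L where "L = esssup ?M ?h"
  have "(\<lambda>p. norm (g p)) \<in> borel_measurable borel"
    by (intro borel_measurable_continuous_onI continuous_on_norm g)
  hence "?h \<in> borel_measurable lborel" by simp
  hence h: "?h \<in> borel_measurable ?M" by (rule measurable_restrict_space1)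
  obtain B where "\<And>p. norm (g p) \<le> B" using bdd by (auto simp: bounded_iff)
  \<comment> \<open>Finiteness matters because \<open>real_of_ereal\<close> would send an infinite
    supremum to 0.\<close>
  hence L_le: "L \<le> ereal B" unfolding L_def by (intro esssup_I[OF h] AE_I2) simp
  have "AE p in ?M. ?h p \<le> L" unfolding L_def by (rule esssup_AE)
  hence "AE p\<in>S in lborel. p \<in> {p. ?h p \<le> L}"
    using \<open>open S\<close> by (simp add: AE_restrict_space_iff)
  hence "AE p\<in>S in lebesgue. p \<in> {p. ?h p \<le> L}" by (rule AE_completion)
  moreover have "closed {p. ?h p \<le> L}"
    by (intro closed_Collect_le continuous_on_ereal continuous_on_norm g continuous_on_const)
  ultimately have "?h p \<le> L"
    using mem_closed_if_AE_lebesgue_open[OF \<open>open S\<close> _ _ \<open>p \<in> S\<close>] by blast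
  with L_le show ?thesis unfolding Linf_norm_def L_def[symmetric] by (cases L) auto
qed

text \<open>Continuity extends the bound to the endpoints, where the half-line estimates also
  evaluate the amplitude.\<close>

lemma norm_le_Linf_norm_interval:
  assumes "a < b" and g: "continuous_on UNIV g" and "bounded (range g)" and "p \<in> {a..b}"
  shows "norm (g p) \<le> Linf_norm {a<..<b} g"
proof -
  have "closure {a<..<b} \<subseteq> {p. norm (g p) \<le> Linf_norm {a<..<b} g}"
    using assms
    by (intro closure_minimal closed_Collect_le continuous_on_norm g continuous_on_const)
       (auto intro: norm_le_Linf_norm)
  with assms(1,4) show ?thesis by auto
qed

lemma set_integral_eq_L1_norm:
  assumes "integrable lborel h" and "0 < \<eta>"
  shows "(LINT r:{0..\<eta>}|lborel. norm (h (p + r))) = L1_norm {p<..<p + \<eta>} h"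
    and "(LINT r:{0..\<eta>}|lborel. norm (h (p - r))) = L1_norm {p - \<eta><..<p} h"
proof -
  have [measurable]: "h \<in> borel_measurable borel" using assms by auto
  have AE: "AE r in lborel. r \<noteq> 0 \<and> r \<noteq> \<eta>"
    using AE_lborel_singleton[of 0] AE_lborel_singleton[of \<eta>] by eventually_elim simp
  have "L1_norm {p<..<p + \<eta>} h =
      (LINT r|lborel. indicator {p<..<p + \<eta>} (p + r) *\<^sub>R norm (h (p + r)))"
    unfolding L1_norm_def set_lebesgue_integral_def
    by (subst lborel_integral_real_affine[of 1 _ p]) simp_all
  also have "\<dots> = (LINT r:{0..\<eta>}|lborel. norm (h (p + r)))"
    unfolding set_lebesgue_integral_def
    by (rule integral_cong_AE, measurable) (use AE in \<open>eventually_elim, auto simp: indicator_def\<close>)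
  finally show "(LINT r:{0..\<eta>}|lborel. norm (h (p + r))) = L1_norm {p<..<p + \<eta>} h" ..
  have "L1_norm {p - \<eta><..<p} h =
      (LINT r|lborel. indicator {p - \<eta><..<p} (p - r) *\<^sub>R norm (h (p - r)))"
    unfolding L1_norm_def set_lebesgue_integral_def
    by (subst lborel_integral_real_affine[of "-1" _ p]) simp_all
  also have "\<dots> = (LINT r:{0..\<eta>}|lborel. norm (h (p - r)))"
    unfolding set_lebesgue_integral_def
    by (rule integral_cong_AE, measurable) (use AE in \<open>eventually_elim, auto simp: indicator_def\<close>)
  finally show "(LINT r:{0..\<eta>}|lborel. norm (h (p - r))) = L1_norm {p - \<eta><..<p} h" ..
qed

section \<open>Splitting the integral at the singular frequency\<close>

text \<open>The factors \<open>1\<close> and \<open>- 1\<close> are left unsimplified to match the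
  sign \<open>\<sigma>\<close> of the half-line estimate.\<close>

lemma lborel_integral_half_lines:
  fixes g :: "real \<Rightarrow> complex"
  assumes g: "integrable lborel g"
  shows "(LINT p|lborel. g p) =
    (LINT r:{0..}|lborel. g (p + 1 * r)) + (LINT r:{0..}|lborel. g (p + (- 1) * r))"
proof -
  have [measurable]: "g \<in> borel_measurable borel" using g by auto
  let ?h = "\<lambda>r. g (p + 1 * r)"
  have h: "integrable lborel ?h" by (rule lborel_integrable_real_affine[OF g]) simp
  hence i: "set_integrable lborel S ?h" if "S \<in> sets lborel" for S
    unfolding set_integrable_def using that by (intro integrable_mult_indicator)
  have "(LINT p|lborel. g p) = (LINT r|lborel. ?h r)"
    by (subst lborel_integral_real_affine[of 1 _ p]) simp_all
  also have "\<dots> = (LINT r:{0..} \<union> {..<0}|lborel. ?h r)"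
  proof -
    have "{0..} \<union> {..<0} = (UNIV :: real set)" by auto
    thus ?thesis by (simp add: set_lebesgue_integral_def)
  qed
  also have "\<dots> = (LINT r:{0..}|lborel. ?h r) + (LINT r:{..<0}|lborel. ?h r)"
    by (rule set_integral_Un) (auto intro!: i[simplified])
  also have "(LINT r:{..<0}|lborel. ?h r) =
      (LINT r|lborel. indicator {..<0} (- r) *\<^sub>R g (p - r))"
    unfolding set_lebesgue_integral_def
    by (subst lborel_integral_real_affine[of "-1" _ 0]) simp_all
  also have "\<dots> = (LINT r:{0..}|lborel. g (p + (- 1) * r))"
    unfolding set_lebesgue_integral_def
    by (rule integral_cong_AE, measurable)
       (use AE_lborel_singleton[of 0] in \<open>eventually_elim, auto simp: indicator_def\<close>)
  finally show ?thesis .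
qed

text \<open>Under \<open>p = p1 + \<sigma> * r\<close> the phase \<open>t * f p - x * p\<close> has
  second derivative \<open>\<sigma> * \<sigma> * t * f''\<close>, which is nonnegative for either
  sign. Hypothesis \<open>M\<close> is the cone condition in the form of a lower bound for the phase
  derivative at distance \<open>\<eta>\<close>.\<close>

lemma norm_half_line_integral_le:
  fixes f f' f'' :: "real \<Rightarrow> real" and w w' g :: "real \<Rightarrow> complex"
  assumes \<sigma>: "\<sigma> = 1 \<or> \<sigma> = - 1" and \<mu>: "0 < \<mu>" "\<mu> \<le> 1"
    and pos: "0 < \<eta>" "0 < k" "0 < t" "0 < M"
    and f: "\<And>p. (f has_real_derivative f' p) (at p)"
    and f': "\<And>p. (f' has_real_derivative f'' p) (at p)"
    and f''_nonneg: "\<And>p. 0 \<le> f'' p"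
    and k: "\<And>r. r \<in> {0..\<eta>} \<Longrightarrow> k \<le> f'' (p1 + \<sigma> * r)"
    and M: "t * M \<le> \<sigma> * (t * f' (p1 + \<sigma> * \<eta>) - x)"
    and w: "\<And>p. (w has_vector_derivative w' p) (at p)"
    and w': "integrable lborel w'"
    and W: "\<And>r. r \<in> {0..\<eta>} \<Longrightarrow> norm (w (p1 + \<sigma> * r)) \<le> W"
    and N: "(LINT r:{0..\<eta>}|lborel. norm (w' (p1 + \<sigma> * r))) \<le> N"
    and W': "\<And>p. norm (w p) \<le> W'"
    and N': "(LINT p|lborel. norm (w' p)) \<le> N'"
    and g: "integrable lborel g"
    and g_eq: "\<And>p. p \<noteq> p1 \<Longrightarrow> g p =
      of_real (\<bar>p - p1\<bar> powr (\<mu> - 1)) * w p * exp (\<i> * of_real (- t * f p + x * p))"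
  shows "norm (LINT r:{0..}|lborel. g (p1 + \<sigma> * r))
    \<le> (3 / \<mu> * W + 2 * (4 * W + N) / k) * t powr (- \<mu> / 2)
      + \<eta> powr (\<mu> - 1) / (t * M) * (4 * W' + N')"
proof -
  have \<sigma>0: "\<sigma> \<noteq> 0" and \<sigma>_abs: "\<bar>\<sigma>\<bar> = 1"
    using \<sigma> by auto
  interpret half_line_phase \<mu> "\<lambda>r. w (p1 + \<sigma> * r)" "\<lambda>r. \<sigma> *\<^sub>R w' (p1 + \<sigma> * r)"
    "\<lambda>r. t * f (p1 + \<sigma> * r) - x * (p1 + \<sigma> * r)" "\<lambda>r. \<sigma> * (t * f' (p1 + \<sigma> * r) - x)"
    "\<lambda>r. t * f'' (p1 + \<sigma> * r)"
  proof
    fix r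
    have d: "((\<lambda>r. p1 + \<sigma> * r) has_real_derivative \<sigma>) (at r)"
      by (auto intro!: derivative_eq_intros)
    have "((\<lambda>r. p1 + \<sigma> * r) has_vector_derivative \<sigma>) (at r)"
      using d by (simp add: has_real_derivative_iff_has_vector_derivative)
    from vector_diff_chain_at[OF this w]
    show "((\<lambda>r. w (p1 + \<sigma> * r)) has_vector_derivative \<sigma> *\<^sub>R w' (p1 + \<sigma> * r)) (at r)"
      by (simp add: o_def)
    have df: "((\<lambda>r. f (p1 + \<sigma> * r)) has_real_derivative f' (p1 + \<sigma> * r) * \<sigma>) (at r)"
      using DERIV_chain2[OF f d] .
    have df': "((\<lambda>r. f' (p1 + \<sigma> * r)) has_real_derivative f'' (p1 + \<sigma> * r) * \<sigma>) (at r)"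
      using DERIV_chain2[OF f' d] .
    show "((\<lambda>r. t * f (p1 + \<sigma> * r) - x * (p1 + \<sigma> * r)) has_real_derivative
        \<sigma> * (t * f' (p1 + \<sigma> * r) - x)) (at r)"
      using DERIV_diff[OF DERIV_cmult[OF df, of t] DERIV_cmult[OF d, of x]]
      by (simp add: right_diff_distrib mult_ac)
    have "((\<lambda>r. \<sigma> * (t * f' (p1 + \<sigma> * r) - x)) has_real_derivative
        \<sigma> * (t * (f'' (p1 + \<sigma> * r) * \<sigma>) - 0)) (at r)"
      by (intro DERIV_cmult DERIV_diff DERIV_const df')
    moreover have "\<sigma> * (t * (f'' (p1 + \<sigma> * r) * \<sigma>) - 0) = t * f'' (p1 + \<sigma> * r)"
      using \<sigma> by auto
    ultimately show "((\<lambda>r. \<sigma> * (t * f' (p1 + \<sigma> * r) - x)) has_real_derivative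
        t * f'' (p1 + \<sigma> * r)) (at r)"
      by (simp only:)
    show "integrable lborel (\<lambda>r. \<sigma> *\<^sub>R w' (p1 + \<sigma> * r))"
      by (intro integrable_scaleR_right lborel_integrable_real_affine w' \<sigma>0)
  qed (use \<mu> pos f''_nonneg in auto)
  have [measurable]: "F \<in> borel_measurable borel" by (rule borel_measurable_F)
  have gi: "integrable lborel (\<lambda>r. g (p1 + \<sigma> * r))"
    by (rule lborel_integrable_real_affine[OF g \<sigma>0])
  have [measurable]: "(\<lambda>r. g (p1 + \<sigma> * r)) \<in> borel_measurable borel" using gi by auto
  \<comment> \<open>The value of \<open>g\<close> at \<open>p1\<close> is unconstrained, so the
    identification with \<open>F\<close> holds only off \<open>r = 0\<close>. It transfers
    integrability from \<open>g\<close> to \<open>F\<close>.\<close>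
  have eq: "AE r in lborel. indicator {0..} r *\<^sub>R g (p1 + \<sigma> * r) = indicator {0..} r *\<^sub>R F r"
    using AE_lborel_singleton[of 0]
  proof eventually_elim
    case (elim r)
    thus ?case
      using \<sigma>0 \<sigma>_abs by (auto simp: indicator_def g_eq F_def abs_mult)
  qed
  have "set_integrable lborel {0..} (\<lambda>r. g (p1 + \<sigma> * r))"
    unfolding set_integrable_def by (rule integrable_mult_indicator[OF _ gi]) simp
  hence Fi: "set_integrable lborel {0..} F"
    unfolding set_integrable_def by (subst (asm) integrable_cong_AE[OF _ _ eq]) measurable
  have "(LINT r:{0..}|lborel. g (p1 + \<sigma> * r)) = (LINT r:{0..}|lborel. F r)"
    unfolding set_lebesgue_integral_def by (rule integral_cong_AE[OF _ _ eq]) measurable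
  also have "norm \<dots> \<le> (3 / \<mu> * W + 2 * (4 * W + N) / k) * t powr (- \<mu> / 2)
      + \<eta> powr (\<mu> - 1) / (t * M) * (4 * W' + N')"
  proof (rule norm_integral_F_half_line_le)
    have "(LINT r|lborel. norm (w' (p1 + \<sigma> * r))) = (LINT p|lborel. norm (w' p))"
      using lborel_integral_real_affine[OF \<sigma>0, of "\<lambda>p. norm (w' p)" p1] \<sigma>_abs by simp
    with N' show "(LINT r|lborel. norm (\<sigma> *\<^sub>R w' (p1 + \<sigma> * r))) \<le> N'"
      using \<sigma>_abs by simp
  qed (use assms \<sigma>_abs Fi in auto)
  finally show ?thesis .
qed

section \<open>Assembling the constants\<close>

text \<open>The infimum is attained by compactness, hence strictly positive; this permits division
  by the minimum of \<open>f''\<close>.\<close>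

lemma cINF_pos_compact:
  fixes g :: "real \<Rightarrow> real"
  assumes "continuous_on S g" "compact S" "S \<noteq> {}" and pos: "\<And>x. x \<in> S \<Longrightarrow> 0 < g x"
  shows "0 < (INF x\<in>S. g x)" and "\<And>x. x \<in> S \<Longrightarrow> (INF x\<in>S. g x) \<le> g x"
proof -
  obtain x0 where "x0 \<in> S" "\<And>x. x \<in> S \<Longrightarrow> g x0 \<le> g x"
    using continuous_attains_inf[OF assms(2,3,1)] by auto
  with cINF_greatest[OF assms(3), of "g x0" g] pos[of x0] show "0 < (INF x\<in>S. g x)" by force
  show "(INF x\<in>S. g x) \<le> g x" if "x \<in> S" for x
    by (rule cINF_lower[OF bdd_belowI2[of _ 0] that]) (use pos in \<open>simp add: less_imp_le\<close>)
qed

theorem theorem2p7: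
  fixes f :: "real \<Rightarrow> real" and \<mu> p1 \<eta> \<epsilon> :: real
    and u0 :: "(real \<Rightarrow> complex) \<Rightarrow> complex"
    and Fu0 w w' :: "real \<Rightarrow> complex"
  assumes "smooth_poly_growth f"
    and "\<And>p. deriv (deriv f) p > 0"
    and "0 < \<mu>" and "\<mu> \<le> 1"
    and "tempered_distribution u0"
    and "distr_is_L1 (fourier_distr u0) Fu0"
    and "bounded (range w)"
    and "\<And>p. (w has_vector_derivative w' p) (at p)"
    and "integrable lborel w'"
    and "\<mu> \<noteq> 1 \<Longrightarrow> w p1 \<noteq> 0"
    and "\<And>p. p \<noteq> p1 \<Longrightarrow> Fu0 p = of_real (\<bar>p - p1\<bar> powr (\<mu> - 1)) * w p"
    and "0 < \<epsilon>" and "\<epsilon> < \<eta>"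
  shows "0 < m_right \<eta> \<epsilon> p1 f \<and> 0 < m_left \<eta> \<epsilon> p1 f \<and>
    (\<forall>(t, x) \<in> spacetime_cone (deriv f (p1 - \<epsilon>)) (deriv f (p1 + \<epsilon>)).
       norm (solution f Fu0 t x)
         \<le> c1 \<eta> \<mu> p1 w w' f * t powr (- \<mu> / 2) + c2 \<eta> \<epsilon> \<mu> p1 w w' f * inverse t)"
proof -
  define f' where "f' = deriv f"
  define f'' where "f'' = deriv f'"
  have smooth: "(deriv ^^ n) f field_differentiable (at p)" for n p
    using assms(1) unfolding smooth_poly_growth_def by blast
  have f: "(f has_real_derivative f' p) (at p)" for p
    using smooth[of 0 p] unfolding f'_def by (simp add: DERIV_deriv_iff_field_differentiable)
  have f': "(f' has_real_derivative f'' p) (at p)" for p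
    using smooth[of 1 p] unfolding f''_def f'_def
    by (simp add: DERIV_deriv_iff_field_differentiable)
  have "f'' field_differentiable (at p)" for p
    using smooth[of 2 p] unfolding f''_def f'_def by (simp add: numeral_2_eq_2)
  hence f''_cont: "continuous_on S f''" for S
    by (meson continuous_at_imp_continuous_on field_differentiable_imp_continuous_at)
  have f''_pos: "0 < f'' p" for p using assms(2) unfolding f''_def f'_def .
  have f'_mono: "f' a < f' b" if "a < b" for a b
    by (rule DERIV_pos_imp_increasing[OF that]) (use f' f''_pos in blast)
  have \<eta>: "0 < \<eta>" using assms by simp
  have w_cont: "continuous_on UNIV w"
    by (meson assms(8) continuous_at_imp_continuous_on has_vector_derivative_continuous)
  have Mr: "0 < m_right \<eta> \<epsilon> p1 f" and Ml: "0 < m_left \<eta> \<epsilon> p1 f"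
    using f'_mono assms unfolding m_right_def m_left_def f'_def[symmetric] by auto
  define kr where "kr = (INF p\<in>{p1..p1 + \<eta>}. f'' p)"
  define kl where "kl = (INF p\<in>{p1 - \<eta>..p1}. f'' p)"
  have kr: "0 < kr" "\<And>p. p \<in> {p1..p1 + \<eta>} \<Longrightarrow> kr \<le> f'' p"
    unfolding kr_def using \<eta> by (auto intro!: cINF_pos_compact f''_cont f''_pos)
  have kl: "0 < kl" "\<And>p. p \<in> {p1 - \<eta>..p1} \<Longrightarrow> kl \<le> f'' p"
    unfolding kl_def using \<eta> by (auto intro!: cINF_pos_compact f''_cont f''_pos)
  define W' where "W' = Linf_norm UNIV w"
  define N' where "N' = L1_norm UNIV w'"
  have W': "norm (w p) \<le> W'" for p
    unfolding W'_def by (rule norm_le_Linf_norm) (use assms w_cont in auto)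
  have N': "(LINT p|lborel. norm (w' p)) \<le> N'"
    unfolding N'_def L1_norm_def set_lebesgue_integral_def by simp
  define Wr where "Wr = Linf_norm {p1<..<p1 + \<eta>} w"
  define Wl where "Wl = Linf_norm {p1 - \<eta><..<p1} w"
  define Nr where "Nr = L1_norm {p1<..<p1 + \<eta>} w'"
  define Nl where "Nl = L1_norm {p1 - \<eta><..<p1} w'"
  have Wr: "norm (w p) \<le> Wr" if "p \<in> {p1..p1 + \<eta>}" for p
    unfolding Wr_def by (rule norm_le_Linf_norm_interval) (use assms w_cont \<eta> that in auto)
  have Wl: "norm (w p) \<le> Wl" if "p \<in> {p1 - \<eta>..p1}" for p
    unfolding Wl_def by (rule norm_le_Linf_norm_interval) (use assms w_cont \<eta> that in auto)
  have "norm (solution f Fu0 t x)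
      \<le> c1 \<eta> \<mu> p1 w w' f * t powr (- \<mu> / 2) + c2 \<eta> \<epsilon> \<mu> p1 w w' f * inverse t"
    if "(t, x) \<in> spacetime_cone (f' (p1 - \<epsilon>)) (f' (p1 + \<epsilon>))" for t x
  proof -
    from that have t: "0 < t" and x: "t * f' (p1 - \<epsilon>) \<le> x" "x \<le> t * f' (p1 + \<epsilon>)"
      unfolding spacetime_cone_def by (auto simp: field_simps)
    define g where "g p = Fu0 p * exp (\<i> * of_real (- t * f p + x * p))" for p
    have Fu0: "integrable lborel Fu0" using assms(6) unfolding distr_is_L1_def by blast
    have "continuous_on UNIV f" by (meson f continuous_at_imp_continuous_on DERIV_isCont)
    hence [measurable]: "f \<in> borel_measurable borel" by (rule borel_measurable_continuous_onI)
    have [measurable]: "Fu0 \<in> borel_measurable borel" using Fu0 by auto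
    have g: "integrable lborel g"
    proof (rule Bochner_Integration.integrable_bound[OF Fu0])
      show "g \<in> borel_measurable lborel" unfolding g_def by measurable
    qed (simp add: g_def norm_mult)
    have g_eq: "g p = of_real (\<bar>p - p1\<bar> powr (\<mu> - 1)) * w p
        * exp (\<i> * of_real (- t * f p + x * p))" if "p \<noteq> p1" for p
      using assms(11)[OF that] by (simp add: g_def)
    define R where "R = (3 / \<mu> * Wr + 2 * (4 * Wr + Nr) / kr) * t powr (- \<mu> / 2)
      + \<eta> powr (\<mu> - 1) / (t * m_right \<eta> \<epsilon> p1 f) * (4 * W' + N')"
    define L where "L = (3 / \<mu> * Wl + 2 * (4 * Wl + Nl) / kl) * t powr (- \<mu> / 2)
      + \<eta> powr (\<mu> - 1) / (t * m_left \<eta> \<epsilon> p1 f) * (4 * W' + N')"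
    have "norm (LINT r:{0..}|lborel. g (p1 + 1 * r)) \<le> R"
      unfolding R_def
    proof (rule norm_half_line_integral_le[where f = f and f' = f' and f'' = f'' and x = x
          and w = w and w' = w'])
      \<comment> \<open>The upper cone inequality \<open>x \<le> t * f' (p1 + \<epsilon>)\<close>
        keeps the phase derivative at \<open>p1 + \<eta>\<close> away from zero; the lower one plays
        this part on the left.\<close>
      show "t * m_right \<eta> \<epsilon> p1 f \<le> 1 * (t * f' (p1 + 1 * \<eta>) - x)"
        using x unfolding m_right_def f'_def[symmetric] by (simp add: algebra_simps)
      show "(LINT r:{0..\<eta>}|lborel. norm (w' (p1 + 1 * r))) \<le> Nr"
        using set_integral_eq_L1_norm(1)[OF assms(9) \<eta>, of p1] by (simp add: Nr_def)
    qed (use assms \<eta> t kr Mr f f' f''_pos Wr W' N' g g_eq in \<open>auto simp: less_imp_le\<close>)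
    moreover have "norm (LINT r:{0..}|lborel. g (p1 + (- 1) * r)) \<le> L"
      unfolding L_def
    proof (rule norm_half_line_integral_le[where f = f and f' = f' and f'' = f'' and x = x
          and w = w and w' = w'])
      show "t * m_left \<eta> \<epsilon> p1 f \<le> (- 1) * (t * f' (p1 + (- 1) * \<eta>) - x)"
        using x unfolding m_left_def f'_def[symmetric] by (simp add: algebra_simps)
      show "(LINT r:{0..\<eta>}|lborel. norm (w' (p1 + (- 1) * r))) \<le> Nl"
        using set_integral_eq_L1_norm(2)[OF assms(9) \<eta>, of p1] by (simp add: Nl_def)
    qed (use assms \<eta> t kl Ml f f' f''_pos Wl W' N' g g_eq in \<open>auto simp: less_imp_le\<close>)
    ultimately have "norm (LINT p|lborel. g p) \<le> R + L"
      unfolding lborel_integral_half_lines[OF g, of p1] by (rule norm_triangle_mono)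
    hence "1 / (2 * pi) * norm (LINT p|lborel. g p) \<le> 1 / (2 * pi) * (R + L)"
      by (rule mult_left_mono) simp
    moreover have "norm (solution f Fu0 t x) = 1 / (2 * pi) * norm (LINT p|lborel. g p)"
      unfolding solution_def g_def norm_mult norm_of_real by simp
    ultimately have "norm (solution f Fu0 t x) \<le> 1 / (2 * pi) * (R + L)" by simp
    also have "\<dots> = c1 \<eta> \<mu> p1 w w' f * t powr (- \<mu> / 2) + c2 \<eta> \<epsilon> \<mu> p1 w w' f * inverse t"
    proof -
      \<comment> \<open>Here \<open>q\<close> is \<open>1 / (2 * pi)\<close>, \<open>T\<close> is
        \<open>t powr (- \<mu> / 2)\<close>, \<open>s\<close> is \<open>inverse t\<close>, and
        \<open>k1\<close>, \<open>k2\<close>, \<open>m1\<close>, \<open>m2\<close> are inverses of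
        the minima and of \<open>m_right\<close>, \<open>m_left\<close>. The coefficient
        \<open>2 * q\<close> becomes the \<open>1 / pi\<close> of \<open>c1\<close>; the closing
        commutation is needed because \<open>c1\<close> lists the left half first.\<close>
      have regroup: "q * (((a * W1 + 2 * B1 * k1) * T + E * (s * m1) * B)
          + ((a * W2 + 2 * B2 * k2) * T + E * (s * m2) * B))
        = ((q * a * W1 + 2 * q * B1 * k1) + (q * a * W2 + 2 * q * B2 * k2)) * T
          + q * E * B * (m1 + m2) * s" for q a W1 W2 B1 B2 k1 k2 T E m1 m2 B s :: real
        by (simp add: algebra_simps)
      have "1 / pi = 2 * (1 / (2 * pi))" by simp
      thus ?thesis
        unfolding R_def L_def c1_def c1_left_def c1_right_def c2_def f'_def[symmetric]
          f''_def[symmetric] kr_def[symmetric] kl_def[symmetric] Wr_def[symmetric]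
          Wl_def[symmetric] Nr_def[symmetric] Nl_def[symmetric] W'_def[symmetric] N'_def[symmetric]
          divide_inverse[of _ kr] divide_inverse[of _ kl] divide_inverse[of _ "t * _"]
          inverse_mult_distrib regroup
        by (simp only: add.commute)
    qed
    finally show ?thesis .
  qed
  with Mr Ml show ?thesis unfolding f'_def by blast
qed

end
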